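(* Let $D$ be a skew field, $\sigma$ a ring automorphism of $D$, $\delta$ a $\sigma$-derivation of $D$, and let $f\in R=D[X;\sigma,\delta]$ be a bounded polynomial with bound $f^*$. Let $\pi\in R$ be a proper twosided divisor of $f^*$. Then $p=(f,\pi)_r$, the right greatest common divisor of $f$ and $\pi$, is a right divisor of $f$ such that $p^*=\pi$. In particular, $f$ has a proper factorization $f=gp$ for some bounded polynomial $g\in R$.
   Context: A $\sigma$-derivation is an additive map $\delta:D\to D$ with $\delta(ab)=\sigma(a)\delta(b)+\delta(a)b$. $R=D[X;\sigma,\delta]$ has left $D$-basis $\{X^n:n\ge0\}$ and $Xa=\sigma(a)X+\delta(a)$ for $a\in D$; it is a left and right principal ideal domain. A polynomial $\alpha$ is twosided if $R\alpha=\alpha R$. A bound $f^*$ of $f$ is a twosided polynomial with $Rf^*=f^*R=\operatorname{Ann}_R(R/Rf)$ (the largest twosided ideal contained in $Rf$), determined up to left multiplication by nonzero elements of $D$, and $f$ is bounded if $f^*\ne0$; equalities between bounds such as $p^*=\pi$ are up to such multiplication (i.e. $Rp^*=R\pi$). A proper twosided divisor $\pi$ of $f^*$ is a twosided polynomial with $f^*=\alpha\pi$, $\alpha$ twosided, and neither $\alpha$ nor $\pi$ a unit. The right greatest common divisor $(f,\pi)_r$ is a generator of the left ideal $Rf+R\pi$. A factorization is proper if neither factor is a unit. *)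

theory Defs
  imports "HOL-Algebra.Ideal" "HOL-Computational_Algebra.Polynomial"
begin

section \<open>Skew polynomial rings over a skew field\<close>

definition ring_automorphism :: "('a::ring_1 \<Rightarrow> 'a) \<Rightarrow> bool" where
  "ring_automorphism \<sigma> \<longleftrightarrow> bij \<sigma> \<and> \<sigma> 1 = 1 \<and>
     (\<forall>a b. \<sigma> (a + b) = \<sigma> a + \<sigma> b) \<and> (\<forall>a b. \<sigma> (a * b) = \<sigma> a * \<sigma> b)"

definition skew_derivation :: "('a::ring_1 \<Rightarrow> 'a) \<Rightarrow> ('a \<Rightarrow> 'a) \<Rightarrow> bool" where
  "skew_derivation \<sigma> \<delta> \<longleftrightarrow>
     (\<forall>a b. \<delta> (a + b) = \<delta> a + \<delta> b) \<and> (\<forall>a b. \<delta> (a * b) = \<sigma> a * \<delta> b + \<delta> a * b)"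

text \<open>
  The library type of polynomials only serves as the free left module with basis
  \<open>X ^ n\<close>, coefficients being written on the left (its own multiplication needs commuting
  coefficients). Left multiplication by \<open>X\<close> is forced by \<open>X a = \<sigma>(a) X + \<delta>(a)\<close>:
  it sends \<open>\<Sum> a\<^sub>i X ^ i\<close> to \<open>\<Sum> \<sigma>(a\<^sub>i) X ^ (i + 1) + \<Sum> \<delta>(a\<^sub>i) X ^ i\<close>.
\<close>

definition skew_lscale :: "'a::ring_1 \<Rightarrow> 'a poly \<Rightarrow> 'a poly" where
  "skew_lscale a p = map_poly (\<lambda>c. a * c) p"

definition skew_X_mult :: "('a::ring_1 \<Rightarrow> 'a) \<Rightarrow> ('a \<Rightarrow> 'a) \<Rightarrow> 'a poly \<Rightarrow> 'a poly" where
  "skew_X_mult \<sigma> \<delta> p = pCons 0 (map_poly \<sigma> p) + map_poly \<delta> p"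

definition skew_mult :: "('a::ring_1 \<Rightarrow> 'a) \<Rightarrow> ('a \<Rightarrow> 'a) \<Rightarrow> 'a poly \<Rightarrow> 'a poly \<Rightarrow> 'a poly" where
  "skew_mult \<sigma> \<delta> p q = (\<Sum>i\<le>degree p. skew_lscale (coeff p i) ((skew_X_mult \<sigma> \<delta> ^^ i) q))"

definition skew_poly_ring :: "('a::ring_1 \<Rightarrow> 'a) \<Rightarrow> ('a \<Rightarrow> 'a) \<Rightarrow> 'a poly ring" where
  "skew_poly_ring \<sigma> \<delta> =
     \<lparr>carrier = UNIV, monoid.mult = skew_mult \<sigma> \<delta>, one = [:1:], zero = 0, add = (+)\<rparr>"

subsection \<open>The construction has the defining properties of \<open>D[X;\<sigma>,\<delta>]\<close>\<close>

context
  fixes \<sigma> \<delta> :: "'a::ring_1 \<Rightarrow> 'a"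
  assumes aut: "ring_automorphism \<sigma>" and der: "skew_derivation \<sigma> \<delta>"
begin

private lemma sd_simps:
  "\<sigma> (a + b) = \<sigma> a + \<sigma> b" "\<sigma> (a * b) = \<sigma> a * \<sigma> b" "\<sigma> 1 = 1"
  "\<delta> (a + b) = \<delta> a + \<delta> b" "\<delta> (a * b) = \<sigma> a * \<delta> b + \<delta> a * b"
  using aut der by (auto simp: ring_automorphism_def skew_derivation_def)

private lemma sd_0: "\<sigma> 0 = 0" "\<delta> 0 = 0" "\<delta> 1 = 0"
  using sd_simps(1)[of 0 0] sd_simps(4)[of 0 0] sd_simps(5)[of 1 1] sd_simps(3) by auto

private lemma coeff_lscale: "coeff (skew_lscale a p) n = a * coeff p n"
  by (simp add: skew_lscale_def coeff_map_poly)

private lemma coeff_X_mult: "coeff (skew_X_mult \<sigma> \<delta> p) n =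
    (case n of 0 \<Rightarrow> 0 | Suc m \<Rightarrow> \<sigma> (coeff p m)) + \<delta> (coeff p n)"
  by (simp add: skew_X_mult_def coeff_pCons coeff_map_poly sd_0 split: nat.split)

private lemma lscale_simps:
  "skew_lscale a (p + q) = skew_lscale a p + skew_lscale a q"
  "skew_lscale (a + b) p = skew_lscale a p + skew_lscale b p"
  "skew_lscale a (skew_lscale b p) = skew_lscale (a * b) p"
  "skew_lscale 0 p = 0" "skew_lscale 1 p = p" "skew_lscale a 0 = 0"
  by (auto intro!: poly_eqI simp: coeff_lscale algebra_simps)

private lemma X_mult_simps:
  "skew_X_mult \<sigma> \<delta> (p + q) = skew_X_mult \<sigma> \<delta> p + skew_X_mult \<sigma> \<delta> q"
  "skew_X_mult \<sigma> \<delta> (skew_lscale a p) =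
     skew_lscale (\<sigma> a) (skew_X_mult \<sigma> \<delta> p) + skew_lscale (\<delta> a) p"
  "skew_X_mult \<sigma> \<delta> 0 = 0"
  by (auto intro!: poly_eqI simp: coeff_lscale coeff_X_mult sd_simps sd_0 algebra_simps
      split: nat.splits)

private lemma X_pow_add:
  "(skew_X_mult \<sigma> \<delta> ^^ i) (p + q) = (skew_X_mult \<sigma> \<delta> ^^ i) p + (skew_X_mult \<sigma> \<delta> ^^ i) q"
  "(skew_X_mult \<sigma> \<delta> ^^ i) 0 = 0"
  by (induction i) (auto simp: X_mult_simps)

private lemma skew_mult_bound:
  assumes "degree p \<le> n"
  shows "skew_mult \<sigma> \<delta> p q =
    (\<Sum>i\<le>n. skew_lscale (coeff p i) ((skew_X_mult \<sigma> \<delta> ^^ i) q))"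
  unfolding skew_mult_def using assms
  by (intro sum.mono_neutral_left) (auto simp: coeff_eq_0 lscale_simps)

private lemma mult_add_left:
  "skew_mult \<sigma> \<delta> (p + q) r = skew_mult \<sigma> \<delta> p r + skew_mult \<sigma> \<delta> q r"
proof -
  let ?n = "max (degree p) (degree q)"
  have "degree (p + q) \<le> ?n" by (simp add: degree_add_le)
  then show ?thesis
    by (simp add: skew_mult_bound[of _ ?n] lscale_simps sum.distrib)
qed

private lemma mult_add_right:
  "skew_mult \<sigma> \<delta> r (p + q) = skew_mult \<sigma> \<delta> r p + skew_mult \<sigma> \<delta> r q"
  by (simp add: skew_mult_def X_pow_add lscale_simps sum.distrib)

private lemma mult_0: "skew_mult \<sigma> \<delta> 0 r = 0"
  by (simp add: skew_mult_def lscale_simps)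

private lemma lscale_sum: "skew_lscale a (sum f A) = (\<Sum>i\<in>A. skew_lscale a (f i))"
  by (induction A rule: infinite_finite_induct) (auto simp: lscale_simps)

private lemma X_mult_sum: "skew_X_mult \<sigma> \<delta> (sum f A) = (\<Sum>i\<in>A. skew_X_mult \<sigma> \<delta> (f i))"
  by (induction A rule: infinite_finite_induct) (auto simp: X_mult_simps)

private lemma mult_sum_left: "skew_mult \<sigma> \<delta> (sum f A) r = (\<Sum>i\<in>A. skew_mult \<sigma> \<delta> (f i) r)"
  by (induction A rule: infinite_finite_induct) (auto simp: mult_0 mult_add_left)

private lemma mult_lscale:
  "skew_mult \<sigma> \<delta> (skew_lscale a p) r = skew_lscale a (skew_mult \<sigma> \<delta> p r)"
proof -
  have "degree (skew_lscale a p) \<le> degree p"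
    by (intro degree_le) (auto simp: coeff_lscale coeff_eq_0)
  then show ?thesis
    by (simp add: skew_mult_bound[of _ "degree p"] coeff_lscale lscale_simps lscale_sum)
qed

private lemma mult_X_mult:
  "skew_mult \<sigma> \<delta> (skew_X_mult \<sigma> \<delta> q) r = skew_X_mult \<sigma> \<delta> (skew_mult \<sigma> \<delta> q r)"
proof -
  let ?n = "degree q" and ?T = "skew_X_mult \<sigma> \<delta>"
  have "degree (?T q) \<le> Suc ?n"
    by (intro degree_le) (auto simp: coeff_X_mult coeff_eq_0 sd_0 split: nat.split)
  then have "skew_mult \<sigma> \<delta> (?T q) r =
      (\<Sum>i\<le>Suc ?n. skew_lscale (case i of 0 \<Rightarrow> 0 | Suc m \<Rightarrow> \<sigma> (coeff q m)) ((?T ^^ i) r))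
    + (\<Sum>i\<le>Suc ?n. skew_lscale (\<delta> (coeff q i)) ((?T ^^ i) r))"
    by (simp add: skew_mult_bound[of _ "Suc ?n"] coeff_X_mult lscale_simps sum.distrib
        del: sum.atMost_Suc)
  also have "\<dots> = (\<Sum>i\<le>?n. skew_lscale (\<sigma> (coeff q i)) ((?T ^^ Suc i) r))
    + (\<Sum>i\<le>?n. skew_lscale (\<delta> (coeff q i)) ((?T ^^ i) r))"
    by (subst sum.atMost_Suc_shift) (simp add: lscale_simps coeff_eq_0 sd_0)
  also have "\<dots> = ?T (skew_mult \<sigma> \<delta> q r)"
    by (simp add: skew_mult_def X_mult_sum X_mult_simps sum.distrib)
  finally show ?thesis .
qed

private lemma mult_X_pow:
  "skew_mult \<sigma> \<delta> ((skew_X_mult \<sigma> \<delta> ^^ i) q) r = (skew_X_mult \<sigma> \<delta> ^^ i) (skew_mult \<sigma> \<delta> q r)"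
  by (induction i) (auto simp: mult_X_mult)

private lemma mult_assoc:
  "skew_mult \<sigma> \<delta> (skew_mult \<sigma> \<delta> p q) r = skew_mult \<sigma> \<delta> p (skew_mult \<sigma> \<delta> q r)"
  by (simp add: skew_mult_def[of _ _ p] mult_sum_left mult_lscale mult_X_pow)

private lemma X_pow_one: "(skew_X_mult \<sigma> \<delta> ^^ i) [:1:] = monom 1 i"
proof (induction i)
  case (Suc i)
  then show ?case
    by (auto intro!: poly_eqI simp: coeff_X_mult sd_0 sd_simps split: nat.split)
qed (simp add: monom_0)

private lemma lscale_monom: "skew_lscale a (monom b n) = monom (a * b) n"
  by (intro poly_eqI) (simp add: coeff_lscale)

private lemma mult_one_right: "skew_mult \<sigma> \<delta> p [:1:] = p"
  by (simp add: skew_mult_def X_pow_one lscale_monom poly_as_sum_of_monoms)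

private lemma mult_one_left: "skew_mult \<sigma> \<delta> [:1:] p = p"
  by (simp add: skew_mult_def lscale_simps)

lemma ring_skew_poly_ring: "ring (skew_poly_ring \<sigma> \<delta>)"
proof (rule ringI)
  show "abelian_group (skew_poly_ring \<sigma> \<delta>)"
    by (rule abelian_groupI) (auto simp: skew_poly_ring_def add_ac intro: exI[of _ "- x" for x])
  show "Group.monoid (skew_poly_ring \<sigma> \<delta>)"
    by (rule Group.monoidI) (auto simp: skew_poly_ring_def mult_assoc mult_one_left mult_one_right)
qed (auto simp: skew_poly_ring_def mult_add_left mult_add_right)

lemma skew_poly_ring_const_mult:
  "[:a:] \<otimes>\<^bsub>skew_poly_ring \<sigma> \<delta>\<^esub> p = skew_lscale a p"
  by (simp add: skew_poly_ring_def skew_mult_def)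

lemma skew_poly_ring_X_mult:
  "monom 1 1 \<otimes>\<^bsub>skew_poly_ring \<sigma> \<delta>\<^esub> p = skew_X_mult \<sigma> \<delta> p"
  by (simp add: skew_poly_ring_def skew_mult_def degree_monom_eq lscale_simps)

lemma skew_poly_ring_commute:
  fixes a :: 'a
  defines "R \<equiv> skew_poly_ring \<sigma> \<delta>"
  shows "monom 1 1 \<otimes>\<^bsub>R\<^esub> [:a:] = ([:\<sigma> a:] \<otimes>\<^bsub>R\<^esub> monom 1 1) \<oplus>\<^bsub>R\<^esub> [:\<delta> a:]"
proof -
  have "skew_X_mult \<sigma> \<delta> [:a:] = skew_lscale (\<sigma> a) (monom 1 1) + [:\<delta> a:]"
    by (auto intro!: poly_eqI simp: coeff_X_mult coeff_lscale coeff_pCons sd_0 split: nat.split)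
  then show ?thesis
    unfolding R_def skew_poly_ring_X_mult skew_poly_ring_const_mult
    by (simp add: skew_poly_ring_def)
qed

lemma skew_poly_ring_X_pow:
  "monom 1 1 [^]\<^bsub>skew_poly_ring \<sigma> \<delta>\<^esub> (n::nat) = monom 1 n"
proof (induction n)
  case 0
  then show ?case by (simp add: nat_pow_def skew_poly_ring_def monom_0)
next
  case (Suc n)
  interpret ring "skew_poly_ring \<sigma> \<delta>" by (rule ring_skew_poly_ring)
  have "monom 1 1 [^]\<^bsub>skew_poly_ring \<sigma> \<delta>\<^esub> Suc n
      = monom 1 1 \<otimes>\<^bsub>skew_poly_ring \<sigma> \<delta>\<^esub> monom 1 1 [^]\<^bsub>skew_poly_ring \<sigma> \<delta>\<^esub> n"
    by (rule nat_pow_Suc2) (simp add: skew_poly_ring_def)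
  then show ?case
    using X_pow_one[of n] X_pow_one[of "Suc n"] by (simp add: Suc[simplified] skew_poly_ring_X_mult[simplified])
qed

end

section \<open>Bounds and twosided divisors\<close>

text \<open>
  For a ring \<open>R\<close>, the left ideal \<open>R a\<close> is \<open>carrier R #> a\<close> and the right ideal \<open>a R\<close> is
  \<open>a <# carrier R\<close>.
\<close>

definition twosided :: "('a, 'm) ring_scheme \<Rightarrow> 'a \<Rightarrow> bool" where
  "twosided R a \<longleftrightarrow> a \<in> carrier R \<and> carrier R #>\<^bsub>R\<^esub> a = a <#\<^bsub>R\<^esub> carrier R"

text \<open>
  The annihilator of the left module \<open>R/I\<close>, for a left ideal \<open>I\<close>: the scalar \<open>r\<close> sends the
  class \<open>I + m\<close> to \<open>I + r m\<close>, and \<open>I\<close> itself is the zero class.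
\<close>

definition quotient_annihilator :: "('a, 'm) ring_scheme \<Rightarrow> 'a set \<Rightarrow> 'a set" where
  "quotient_annihilator R I =
     {r \<in> carrier R. \<forall>m \<in> carrier R. I +>\<^bsub>R\<^esub> (r \<otimes>\<^bsub>R\<^esub> m) = I}"

text \<open>
  A bound is only determined up to left multiplication by units, so \<open>f\<^sup>* = b\<close> is rendered as the
  relation \<open>is_bound R f b\<close>. The zero polynomial is a bound of every unbounded polynomial.
\<close>

definition is_bound :: "('a, 'm) ring_scheme \<Rightarrow> 'a \<Rightarrow> 'a \<Rightarrow> bool" where
  "is_bound R f b \<longleftrightarrow> twosided R b \<and>
     carrier R #>\<^bsub>R\<^esub> b = quotient_annihilator R (carrier R #>\<^bsub>R\<^esub> f)"

definition bounded_elem :: "('a, 'm) ring_scheme \<Rightarrow> 'a \<Rightarrow> bool" where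
  "bounded_elem R f \<longleftrightarrow> f \<in> carrier R \<and> (\<exists>b. is_bound R f b \<and> b \<noteq> \<zero>\<^bsub>R\<^esub>)"

definition proper_twosided_divisor :: "('a, 'm) ring_scheme \<Rightarrow> 'a \<Rightarrow> 'a \<Rightarrow> bool" where
  "proper_twosided_divisor R \<pi> b \<longleftrightarrow> twosided R \<pi> \<and> \<pi> \<notin> Units R \<and>
     (\<exists>\<alpha>. twosided R \<alpha> \<and> \<alpha> \<notin> Units R \<and> b = \<alpha> \<otimes>\<^bsub>R\<^esub> \<pi>)"

definition right_divides :: "('a, 'm) ring_scheme \<Rightarrow> 'a \<Rightarrow> 'a \<Rightarrow> bool" where
  "right_divides R p f \<longleftrightarrow> (\<exists>g \<in> carrier R. f = g \<otimes>\<^bsub>R\<^esub> p)"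

definition is_rgcd :: "('a, 'm) ring_scheme \<Rightarrow> 'a \<Rightarrow> 'a \<Rightarrow> 'a \<Rightarrow> bool" where
  "is_rgcd R f g p \<longleftrightarrow> p \<in> carrier R \<and>
     carrier R #>\<^bsub>R\<^esub> p = (carrier R #>\<^bsub>R\<^esub> f) <+>\<^bsub>R\<^esub> (carrier R #>\<^bsub>R\<^esub> g)"

end

theory Submission
  imports Defs
begin

text \<open>
  Let \<open>f\<^sup>* = \<alpha> \<pi>\<close> and let \<open>I\<close> be the largest twosided ideal contained in \<open>R p = R f + R \<pi>\<close>.
  It contains \<open>R \<pi>\<close>. Conversely \<open>\<alpha> I\<close> is a twosided ideal, since \<open>\<alpha>\<close> is twosided, and
  \<open>\<alpha> I \<subseteq> R f + \<alpha> R \<pi> = R f + R f\<^sup>* = R f\<close>. Hence \<open>\<alpha> I \<subseteq> R f\<^sup>* = \<alpha> R \<pi>\<close>, and cancelling \<open>\<alpha>\<close>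
  gives \<open>I = R \<pi>\<close>, that is, \<open>p\<^sup>* = \<pi>\<close>. If \<open>f = g p\<close>, commuting \<open>f\<^sup>*\<close> past a cofactor moves
  a factor of \<open>f\<^sup>*\<close> to its other side; so \<open>f\<^sup>* \<in> R f\<close> gives \<open>f\<^sup>* \<in> f R \<subseteq> g R\<close>, whence
  \<open>f\<^sup>* \<in> R g\<close> and \<open>g\<close> is bounded.
\<close>

section \<open>Noncommutative Euclidean domains\<close>

text \<open>One norm \<open>N\<close> serves both divisions. This lets a single element of least
  norm generate a twosided ideal from the left and from the right at once.\<close>

locale twosided_euclidean_domain = ring R for R (structure) +
  fixes N :: "'a \<Rightarrow> nat"
  assumes no_zero_divisors:
      "\<lbrakk>a \<in> carrier R; b \<in> carrier R; a \<otimes> b = \<zero>\<rbrakk> \<Longrightarrow> a = \<zero> \<or> b = \<zero>"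
    and left_division: "\<lbrakk>a \<in> carrier R; b \<in> carrier R; b \<noteq> \<zero>\<rbrakk> \<Longrightarrow>
      \<exists>q\<in>carrier R. \<exists>r\<in>carrier R. a = q \<otimes> b \<oplus> r \<and> (r = \<zero> \<or> N r < N b)"
    and right_division: "\<lbrakk>a \<in> carrier R; b \<in> carrier R; b \<noteq> \<zero>\<rbrakk> \<Longrightarrow>
      \<exists>q\<in>carrier R. \<exists>r\<in>carrier R. a = b \<otimes> q \<oplus> r \<and> (r = \<zero> \<or> N r < N b)"
begin

section \<open>Cancellation, units and principal ideals\<close>

lemma left_ideal_iff: "x \<in> carrier R #> a \<longleftrightarrow> (\<exists>r\<in>carrier R. x = r \<otimes> a)"
  by (auto simp: r_coset_def)

lemma right_ideal_iff: "x \<in> a <# carrier R \<longleftrightarrow> (\<exists>r\<in>carrier R. x = a \<otimes> r)"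
  by (auto simp: l_coset_def)

lemma eq_of_minus_eq_zero:
  assumes "x \<in> carrier R" "y \<in> carrier R" "x \<ominus> y = \<zero>"
  shows "x = y"
proof -
  have "x = (x \<ominus> y) \<oplus> y" using assms(1,2) by (simp add: minus_eq a_assoc l_neg)
  then show ?thesis using assms by simp
qed

lemma left_cancel:
  assumes "a \<in> carrier R" "x \<in> carrier R" "y \<in> carrier R" "a \<noteq> \<zero>" "a \<otimes> x = a \<otimes> y"
  shows "x = y"
proof -
  have "a \<otimes> (x \<ominus> y) = \<zero>"
    using assms by (simp add: minus_eq r_distr r_minus r_neg)
  then have "x \<ominus> y = \<zero>" using no_zero_divisors assms by blast
  then show ?thesis using eq_of_minus_eq_zero assms by blast
qed

lemma right_cancel:
  assumes "a \<in> carrier R" "x \<in> carrier R" "y \<in> carrier R" "a \<noteq> \<zero>" "x \<otimes> a = y \<otimes> a"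
  shows "x = y"
proof -
  have "(x \<ominus> y) \<otimes> a = \<zero>"
    using assms by (simp add: minus_eq l_distr l_minus r_neg)
  then have "x \<ominus> y = \<zero>" using no_zero_divisors assms by blast
  then show ?thesis using eq_of_minus_eq_zero assms by blast
qed

lemma left_ideal_mono:
  assumes "a \<in> carrier R" "b \<in> carrier R #> a"
  shows "carrier R #> b \<subseteq> carrier R #> a"
proof
  fix x assume "x \<in> carrier R #> b"
  then obtain r s where "r \<in> carrier R" "s \<in> carrier R" "x = r \<otimes> b" "b = s \<otimes> a"
    using assms by (auto simp: left_ideal_iff)
  then have "x = (r \<otimes> s) \<otimes> a" "r \<otimes> s \<in> carrier R" using assms by (auto simp: m_assoc)
  then show "x \<in> carrier R #> a" unfolding left_ideal_iff by blast
qed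

text \<open>From \<open>x \<otimes> a = \<one>\<close> follows
  \<open>a \<otimes> x \<otimes> a = a\<close>, and cancelling \<open>a\<close> on the right makes
  \<open>x\<close> a two-sided inverse. If \<open>a\<close> is zero, the hypothesis collapses the
  ring to the zero ring, where \<open>\<zero>\<close> is a unit.\<close>

lemma UnitsI_left_inverse:
  assumes "a \<in> carrier R" "x \<in> carrier R" "x \<otimes> a = \<one>"
  shows "a \<in> Units R"
proof (cases "a = \<zero>")
  case True
  then have "\<one> = \<zero>" using assms by simp
  then show ?thesis using assms True by (auto simp: Units_def)
next
  case False
  have "a \<otimes> (x \<otimes> a) = a \<otimes> \<one>" using assms by simp
  then have "(a \<otimes> x) \<otimes> a = \<one> \<otimes> a" using assms by (simp add: m_assoc)
  then have "a \<otimes> x = \<one>" using right_cancel[of a "a \<otimes> x" \<one>] False assms by simp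
  then show ?thesis using assms by (auto simp: Units_def)
qed

lemma left_ideal_unit:
  assumes "u \<in> Units R" "a \<in> carrier R"
  shows "carrier R #> (u \<otimes> a) = carrier R #> a"
proof
  have "a = inv u \<otimes> (u \<otimes> a)" using assms
    by (metis Units_closed Units_inv_closed Units_l_inv l_one m_assoc)
  then show "carrier R #> a \<subseteq> carrier R #> (u \<otimes> a)"
    using assms by (intro left_ideal_mono) (auto simp: left_ideal_iff)
  show "carrier R #> (u \<otimes> a) \<subseteq> carrier R #> a"
    using assms by (intro left_ideal_mono) (auto simp: left_ideal_iff)
qed

text \<open>A nonzero element of least norm generates: the remainder of any other element lies in
  \<open>I\<close> again and is too small to be nonzero. Right closure is a premise of the last
  conclusion only, so that the lemma covers sums of left ideals as well as annihilators.\<close>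

lemma minimal_element_generates:
  assumes sub: "I \<subseteq> carrier R" and zero: "\<zero> \<in> I"
    and minus: "\<And>x y. x \<in> I \<Longrightarrow> y \<in> I \<Longrightarrow> x \<ominus> y \<in> I"
    and left: "\<And>r x. r \<in> carrier R \<Longrightarrow> x \<in> I \<Longrightarrow> r \<otimes> x \<in> I"
  obtains b where "b \<in> carrier R" "I = carrier R #> b"
    "(\<And>r x. r \<in> carrier R \<Longrightarrow> x \<in> I \<Longrightarrow> x \<otimes> r \<in> I) \<Longrightarrow> I = b <# carrier R"
proof (cases "I = {\<zero>}")
  case True
  have "\<exists>r. r \<in> carrier R" using one_closed by blast
  then have "carrier R #> \<zero> = {\<zero>}" "\<zero> <# carrier R = {\<zero>}"
    by (auto simp: left_ideal_iff right_ideal_iff)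
  then show ?thesis using that[of \<zero>] True by simp
next
  case False
  then have "\<exists>b. b \<in> I \<and> b \<noteq> \<zero>" using zero by auto
  then obtain b where b: "b \<in> I" "b \<noteq> \<zero>"
    and min: "\<And>x. x \<in> I \<Longrightarrow> x \<noteq> \<zero> \<Longrightarrow> N b \<le> N x"
    using ex_has_least_nat[of "\<lambda>b. b \<in> I \<and> b \<noteq> \<zero>" _ N] by blast
  have bc: "b \<in> carrier R" using b sub by auto
  \<comment> \<open>The remainder argument, stated for an arbitrary multiple \<open>y\<close> of
    \<open>b\<close>, so that it applies to left and to right division alike.\<close>
  have rem: "x = y"
    if "x \<in> I" "y \<in> I" "r \<in> carrier R" "x = y \<oplus> r" "r = \<zero> \<or> N r < N b" for x y r
  proof -
    have c: "x \<in> carrier R" "y \<in> carrier R" using that sub by auto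
    have "r = x \<ominus> y" using c that(3,4) by (simp add: minus_eq a_ac r_neg1 r_neg)
    then have "r \<in> I" using minus[OF that(1,2)] by (rule ssubst)
    then have "r = \<zero>" using min that(5) leD by blast
    then show ?thesis using that c by simp
  qed
  show ?thesis
  proof (rule that[OF bc])
    show "I = carrier R #> b"
    proof (intro equalityI subsetI)
      fix x assume x: "x \<in> I"
      then obtain q r where "q \<in> carrier R" "r \<in> carrier R" "x = q \<otimes> b \<oplus> r" "r = \<zero> \<or> N r < N b"
        using left_division[of x b] b bc sub by blast
      then have "x = q \<otimes> b" using rem[of x "q \<otimes> b" r] x left b by blast
      then show "x \<in> carrier R #> b" using \<open>q \<in> carrier R\<close> by (auto simp: left_ideal_iff)
    qed (use left b in \<open>auto simp: left_ideal_iff\<close>)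
    assume right: "\<And>r x. r \<in> carrier R \<Longrightarrow> x \<in> I \<Longrightarrow> x \<otimes> r \<in> I"
    show "I = b <# carrier R"
    proof (intro equalityI subsetI)
      fix x assume x: "x \<in> I"
      then obtain q r where "q \<in> carrier R" "r \<in> carrier R" "x = b \<otimes> q \<oplus> r" "r = \<zero> \<or> N r < N b"
        using right_division[of x b] b bc sub by blast
      then have "x = b \<otimes> q" using rem[of x "b \<otimes> q" r] x right b by blast
      then show "x \<in> b <# carrier R" using \<open>q \<in> carrier R\<close> by (auto simp: right_ideal_iff)
    qed (use right b in \<open>auto simp: right_ideal_iff\<close>)
  qed
qed

section \<open>Left ideals, their cosets and annihilators of cyclic modules\<close>

lemma left_ideal_minus:
  assumes "a \<in> carrier R" "x \<in> carrier R #> a" "y \<in> carrier R #> a"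
  shows "x \<ominus> y \<in> carrier R #> a"
proof -
  obtain r s where rs: "r \<in> carrier R" "s \<in> carrier R" "x = r \<otimes> a" "y = s \<otimes> a"
    using assms by (auto simp: left_ideal_iff)
  then have "x \<ominus> y = (r \<ominus> s) \<otimes> a" using assms by (simp add: minus_eq l_distr l_minus)
  then show ?thesis using rs by (auto simp: left_ideal_iff)
qed

lemma left_ideal_add:
  assumes "a \<in> carrier R" "x \<in> carrier R #> a" "y \<in> carrier R #> a"
  shows "x \<oplus> y \<in> carrier R #> a"
proof -
  obtain r s where rs: "r \<in> carrier R" "s \<in> carrier R" "x = r \<otimes> a" "y = s \<otimes> a"
    using assms by (auto simp: left_ideal_iff)
  then have "x \<oplus> y = (r \<oplus> s) \<otimes> a" using assms by (simp add: l_distr)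
  then show ?thesis using rs by (auto simp: left_ideal_iff)
qed

lemma left_ideal_mult:
  assumes "a \<in> carrier R" "x \<in> carrier R #> a" "r \<in> carrier R"
  shows "r \<otimes> x \<in> carrier R #> a"
  using assms by (auto simp: left_ideal_iff simp flip: m_assoc)

lemma self_in_left_ideal: "a \<in> carrier R \<Longrightarrow> a \<in> carrier R #> a"
  unfolding left_ideal_iff by (rule bexI[of _ \<one>]) auto

lemma zero_in_left_ideal: "a \<in> carrier R \<Longrightarrow> \<zero> \<in> carrier R #> a"
  unfolding left_ideal_iff by (rule bexI[of _ \<zero>]) auto

text \<open>Bridge from cosets to membership, used to remove the quotient module from
  \<open>quotient_annihilator\<close>. One direction looks at the element
  \<open>\<zero> \<oplus> x\<close> of the coset; the other translates by \<open>x\<close> inside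
  the ideal.\<close>

lemma left_ideal_coset_eq_iff:
  assumes a: "a \<in> carrier R" and x: "x \<in> carrier R"
  shows "(carrier R #> a) +> x = carrier R #> a \<longleftrightarrow> x \<in> carrier R #> a"
proof
  assume "(carrier R #> a) +> x = carrier R #> a"
  moreover have "\<zero> \<oplus> x \<in> (carrier R #> a) +> x"
    unfolding a_r_coset_def' using zero_in_left_ideal[OF a] by blast
  ultimately show "x \<in> carrier R #> a" using x by simp
next
  assume *: "x \<in> carrier R #> a"
  show "(carrier R #> a) +> x = carrier R #> a"
  proof (intro equalityI subsetI)
    fix y assume "y \<in> carrier R #> a"
    moreover from this have "y \<in> carrier R" using a by (auto simp: left_ideal_iff)
    ultimately have "y = (y \<ominus> x) \<oplus> x" "y \<ominus> x \<in> carrier R #> a"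
      using * a x left_ideal_minus by (auto simp: minus_eq a_assoc l_neg)
    then show "y \<in> (carrier R #> a) +> x" unfolding a_r_coset_def' by blast
  qed (use * a left_ideal_add in \<open>auto simp: a_r_coset_def'\<close>)
qed

lemma quotient_annihilator_iff:
  assumes "a \<in> carrier R"
  shows "x \<in> quotient_annihilator R (carrier R #> a) \<longleftrightarrow>
    x \<in> carrier R \<and> (\<forall>m\<in>carrier R. x \<otimes> m \<in> carrier R #> a)"
  using left_ideal_coset_eq_iff[OF assms] by (auto simp: quotient_annihilator_def)

text \<open>An annihilating element kills in particular the class of \<open>\<one>\<close>.\<close>

lemma quotient_annihilator_subset:
  assumes "a \<in> carrier R"
  shows "quotient_annihilator R (carrier R #> a) \<subseteq> carrier R #> a"
proof
  fix x assume "x \<in> quotient_annihilator R (carrier R #> a)"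
  then have "x \<in> carrier R" "x \<otimes> \<one> \<in> carrier R #> a"
    using quotient_annihilator_iff[OF assms] one_closed by blast+
  then show "x \<in> carrier R #> a" by simp
qed

section \<open>Twosided elements and bounds\<close>

lemma twosided_commute:
  assumes "twosided R a" "r \<in> carrier R"
  obtains s where "s \<in> carrier R" "r \<otimes> a = a \<otimes> s"
proof -
  have "r \<otimes> a \<in> carrier R #> a" using assms(2) by (auto simp: left_ideal_iff)
  then have "r \<otimes> a \<in> a <# carrier R" using assms(1) by (simp add: twosided_def)
  then show ?thesis using that unfolding right_ideal_iff by blast
qed

lemma twosided_commute':
  assumes "twosided R a" "r \<in> carrier R"
  obtains s where "s \<in> carrier R" "a \<otimes> r = s \<otimes> a"
proof -
  have "a \<otimes> r \<in> a <# carrier R" using assms(2) by (auto simp: right_ideal_iff)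
  then have "a \<otimes> r \<in> carrier R #> a" using assms(1) by (simp add: twosided_def)
  then show ?thesis using that unfolding left_ideal_iff by blast
qed

text \<open>Commute \<open>c\<close> past a cofactor and cancel that cofactor:
  \<open>a \<otimes> c = c \<otimes> s = a \<otimes> b \<otimes> s\<close> gives
  \<open>c = b \<otimes> s\<close>, and
  \<open>c \<otimes> b = t \<otimes> c = t \<otimes> a \<otimes> b\<close> gives
  \<open>c = t \<otimes> a\<close>.\<close>

lemma twosided_factor_swap:
  assumes "twosided R c" "c \<noteq> \<zero>" "a \<in> carrier R" "b \<in> carrier R" "c = a \<otimes> b"
  shows "c \<in> b <# carrier R" and "c \<in> carrier R #> a"
proof -
  have nz: "a \<noteq> \<zero>" "b \<noteq> \<zero>" using assms by auto
  have c: "c \<in> carrier R" using assms by auto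
  obtain s where s: "s \<in> carrier R" "a \<otimes> c = c \<otimes> s" using twosided_commute assms by blast
  then have "a \<otimes> c = a \<otimes> (b \<otimes> s)" using assms by (simp add: m_assoc)
  then have "c = b \<otimes> s" using left_cancel[of a c "b \<otimes> s"] nz assms s c by blast
  then show "c \<in> b <# carrier R" using s by (auto simp: right_ideal_iff)
  obtain t where t: "t \<in> carrier R" "c \<otimes> b = t \<otimes> c" using twosided_commute' assms by blast
  then have "c \<otimes> b = (t \<otimes> a) \<otimes> b" using assms by (simp add: m_assoc)
  then have "c = t \<otimes> a" using right_cancel[of b c "t \<otimes> a"] nz assms t c by blast
  then show "c \<in> carrier R #> a" using t by (auto simp: left_ideal_iff)
qed

text \<open>This is the maximality of the annihilator among twosided ideals inside
  \<open>R a\<close>: a right factor \<open>m\<close> moves to the left of \<open>c\<close>, so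
  products with \<open>m\<close> stay in \<open>R c\<close>, which lies in
  \<open>R a\<close>.\<close>

lemma twosided_in_annihilator:
  assumes "twosided R c" "a \<in> carrier R" "c \<in> carrier R #> a"
  shows "carrier R #> c \<subseteq> quotient_annihilator R (carrier R #> a)"
proof
  fix x assume "x \<in> carrier R #> c"
  then obtain r where r: "r \<in> carrier R" "x = r \<otimes> c" by (auto simp: left_ideal_iff)
  have c: "c \<in> carrier R" using assms by (simp add: twosided_def)
  have "x \<otimes> m \<in> carrier R #> a" if m: "m \<in> carrier R" for m
  proof -
    obtain s where "s \<in> carrier R" "c \<otimes> m = s \<otimes> c" using twosided_commute' assms m by blast
    then have "x \<otimes> m = (r \<otimes> s) \<otimes> c" "r \<otimes> s \<in> carrier R" using r c m by (auto simp: m_assoc)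
    then show ?thesis using left_ideal_mult assms by simp
  qed
  then show "x \<in> quotient_annihilator R (carrier R #> a)"
    using assms r c by (simp add: quotient_annihilator_iff)
qed

text \<open>The annihilator is closed under multiplication from both sides, so its generator of
  least norm generates it as a left and as a right ideal and is therefore twosided. For unbounded
  \<open>a\<close> this generator is zero.\<close>

lemma is_bound_exists:
  assumes a: "a \<in> carrier R"
  obtains b where "is_bound R a b"
proof -
  let ?I = "quotient_annihilator R (carrier R #> a)"
  have right: "x \<otimes> r \<in> ?I" if "r \<in> carrier R" "x \<in> ?I" for r x
    using that a by (auto simp: quotient_annihilator_iff m_assoc)
  obtain b where b: "b \<in> carrier R" "?I = carrier R #> b"
    "(\<And>r x. r \<in> carrier R \<Longrightarrow> x \<in> ?I \<Longrightarrow> x \<otimes> r \<in> ?I) \<Longrightarrow> ?I = b <# carrier R"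
  proof (rule minimal_element_generates[of ?I])
    show "?I \<subseteq> carrier R" "\<zero> \<in> ?I"
      using a zero_in_left_ideal by (auto simp: quotient_annihilator_iff)
    show "x \<ominus> y \<in> ?I" if "x \<in> ?I" "y \<in> ?I" for x y
    proof -
      have c: "x \<in> carrier R" "y \<in> carrier R" using that a by (auto simp: quotient_annihilator_iff)
      have "(x \<ominus> y) \<otimes> m = x \<otimes> m \<ominus> y \<otimes> m" if "m \<in> carrier R" for m
        using c that by (simp add: minus_eq l_distr l_minus)
      then show ?thesis using that a c by (simp add: quotient_annihilator_iff left_ideal_minus)
    qed
    show "r \<otimes> x \<in> ?I" if "r \<in> carrier R" "x \<in> ?I" for r x
      using that a by (simp add: quotient_annihilator_iff m_assoc left_ideal_mult)
  qed blast
  have "?I = b <# carrier R" by (rule b(3)) (rule right)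
  then have "is_bound R a b" using b by (simp add: is_bound_def twosided_def)
  then show ?thesis by (rule that)
qed

text \<open>The left ideal of the bound contains \<open>c\<close> by maximality, and a left ideal
  with a nonzero element has a nonzero generator.\<close>

lemma bounded_elemI:
  assumes "twosided R c" "c \<noteq> \<zero>" "a \<in> carrier R" "c \<in> carrier R #> a"
  shows "bounded_elem R a"
proof -
  obtain b where b: "is_bound R a b" using is_bound_exists assms by blast
  have c: "c \<in> carrier R" using assms by (simp add: twosided_def)
  have "c \<in> carrier R #> b"
    using b self_in_left_ideal[OF c] twosided_in_annihilator assms by (auto simp: is_bound_def)
  then have "b \<noteq> \<zero>" using assms(2) by (auto simp: left_ideal_iff)
  then show ?thesis using b assms by (auto simp: bounded_elem_def)
qed

text \<open>Boundedness provides only some nonzero bound. All bounds of \<open>a\<close> generate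
  the same left ideal, so this carries over to any given one.\<close>

lemma bounded_elem_bound_nonzero:
  assumes "bounded_elem R a" "is_bound R a b"
  shows "b \<noteq> \<zero>"
proof
  assume "b = \<zero>"
  obtain c where c: "is_bound R a c" "c \<noteq> \<zero>" using assms by (auto simp: bounded_elem_def)
  then have "c \<in> carrier R #> c" by (auto intro: self_in_left_ideal simp: is_bound_def twosided_def)
  also have "\<dots> = carrier R #> b" using c assms by (simp add: is_bound_def)
  finally show False using c \<open>b = \<zero>\<close> by (auto simp: left_ideal_iff)
qed

section \<open>Right greatest common divisors and their bounds\<close>

lemma left_ideal_sum_iff:
  "x \<in> set_add R (carrier R #> a) (carrier R #> b) \<longleftrightarrow>
    (\<exists>r\<in>carrier R. \<exists>s\<in>carrier R. x = r \<otimes> a \<oplus> s \<otimes> b)"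
proof
  assume "x \<in> set_add R (carrier R #> a) (carrier R #> b)"
  then obtain y z where "y \<in> carrier R #> a" "z \<in> carrier R #> b" "x = y \<oplus> z"
    by (auto simp: set_add_def')
  then show "\<exists>r\<in>carrier R. \<exists>s\<in>carrier R. x = r \<otimes> a \<oplus> s \<otimes> b"
    unfolding left_ideal_iff by blast
next
  assume "\<exists>r\<in>carrier R. \<exists>s\<in>carrier R. x = r \<otimes> a \<oplus> s \<otimes> b"
  then obtain y z where "y \<in> carrier R #> a" "z \<in> carrier R #> b" "x = y \<oplus> z"
    unfolding left_ideal_iff by blast
  then show "x \<in> set_add R (carrier R #> a) (carrier R #> b)"
    by (auto simp: set_add_def')
qed

lemma is_rgcd_exists:
  assumes "a \<in> carrier R" "b \<in> carrier R"
  obtains p where "is_rgcd R a b p"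
proof -
  let ?I = "set_add R (carrier R #> a) (carrier R #> b)"
  obtain p where "p \<in> carrier R" "?I = carrier R #> p"
  proof (rule minimal_element_generates[of ?I])
    show "?I \<subseteq> carrier R" using assms by (auto simp: left_ideal_sum_iff)
    show "\<zero> \<in> ?I" unfolding left_ideal_sum_iff
      by (intro bexI[of _ \<zero>]) (use assms in auto)
    show "x \<ominus> y \<in> ?I" if xy: "x \<in> ?I" "y \<in> ?I" for x y
    proof -
      obtain r s r' s' where c: "r \<in> carrier R" "s \<in> carrier R" "r' \<in> carrier R" "s' \<in> carrier R"
        and e: "x = r \<otimes> a \<oplus> s \<otimes> b" "y = r' \<otimes> a \<oplus> s' \<otimes> b"
        using xy by (auto simp: left_ideal_sum_iff)
      have "x \<ominus> y = (r \<ominus> r') \<otimes> a \<oplus> (s \<ominus> s') \<otimes> b"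
        unfolding e using c assms by (simp add: minus_eq l_distr l_minus minus_add a_ac)
      moreover have "r \<ominus> r' \<in> carrier R" "s \<ominus> s' \<in> carrier R" using c by auto
      ultimately show ?thesis unfolding left_ideal_sum_iff by blast
    qed
    show "r \<otimes> x \<in> ?I" if r: "r \<in> carrier R" and x: "x \<in> ?I" for r x
    proof -
      obtain s t where c: "s \<in> carrier R" "t \<in> carrier R" and e: "x = s \<otimes> a \<oplus> t \<otimes> b"
        using x by (auto simp: left_ideal_sum_iff)
      have "r \<otimes> x = (r \<otimes> s) \<otimes> a \<oplus> (r \<otimes> t) \<otimes> b"
        unfolding e using c r assms by (simp add: r_distr m_assoc)
      moreover have "r \<otimes> s \<in> carrier R" "r \<otimes> t \<in> carrier R" using c r by auto
      ultimately show ?thesis unfolding left_ideal_sum_iff by blast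
    qed
  qed blast
  then have "is_rgcd R a b p" by (simp add: is_rgcd_def)
  then show ?thesis by (rule that)
qed

lemma is_rgcd_divides:
  assumes "is_rgcd R a b p" "a \<in> carrier R" "b \<in> carrier R"
  shows "a \<in> carrier R #> p" and "b \<in> carrier R #> p"
proof -
  have "a = \<one> \<otimes> a \<oplus> \<zero> \<otimes> b" "b = \<zero> \<otimes> a \<oplus> \<one> \<otimes> b" using assms by auto
  then have "a \<in> set_add R (carrier R #> a) (carrier R #> b)"
    "b \<in> set_add R (carrier R #> a) (carrier R #> b)"
    unfolding left_ideal_sum_iff by blast+
  then show "a \<in> carrier R #> p" "b \<in> carrier R #> p" using assms by (auto simp: is_rgcd_def)
qed

text \<open>The bound of \<open>f\<close> appears in factored form because the argument multiplies
  by \<open>\<alpha>\<close>, compares with that bound, and then cancels \<open>\<alpha>\<close>;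
  \<open>nz\<close> permits the cancellation.\<close>

lemma rgcd_is_bound:
  assumes f: "f \<in> carrier R" and bound: "is_bound R f (\<alpha> \<otimes> \<pi>)" and nz: "\<alpha> \<noteq> \<zero>"
    and \<alpha>: "twosided R \<alpha>" and \<pi>: "twosided R \<pi>" and p: "is_rgcd R f \<pi> p"
  shows "is_bound R p \<pi>"
proof -
  have [simp]: "\<alpha> \<in> carrier R" "\<pi> \<in> carrier R" "p \<in> carrier R" "f \<in> carrier R"
    using \<alpha> \<pi> p f by (auto simp: twosided_def is_rgcd_def)
  let ?I = "quotient_annihilator R (carrier R #> p)"
  have bound_in: "carrier R #> (\<alpha> \<otimes> \<pi>) \<subseteq> carrier R #> f"
    using bound quotient_annihilator_subset[OF f] by (simp add: is_bound_def)
  \<comment> \<open>Multiplication by \<open>\<alpha>\<close> carries \<open>R f + R \<pi>\<close>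
    into \<open>R f\<close>: once \<open>\<alpha>\<close> has moved past \<open>s\<close>, the
    second summand becomes a left multiple of the bound.\<close>
  have mult_in: "\<alpha> \<otimes> y \<in> carrier R #> f" if y: "y \<in> carrier R #> p" for y
  proof -
    obtain r s where rs: "r \<in> carrier R" "s \<in> carrier R" "y = r \<otimes> f \<oplus> s \<otimes> \<pi>"
      using y p by (auto simp: is_rgcd_def left_ideal_sum_iff)
    obtain t where t: "t \<in> carrier R" "\<alpha> \<otimes> s = t \<otimes> \<alpha>"
      using twosided_commute'[OF \<alpha>] rs by blast
    have "\<alpha> \<otimes> y = (\<alpha> \<otimes> r) \<otimes> f \<oplus> (\<alpha> \<otimes> s) \<otimes> \<pi>"
      unfolding rs using rs(1,2) by (simp add: r_distr m_assoc)
    also have "\<dots> = (\<alpha> \<otimes> r) \<otimes> f \<oplus> t \<otimes> (\<alpha> \<otimes> \<pi>)" unfolding t using t by (simp add: m_assoc)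
    also have "\<dots> \<in> carrier R #> f"
    proof (rule left_ideal_add)
      show "(\<alpha> \<otimes> r) \<otimes> f \<in> carrier R #> f" using rs by (auto simp: left_ideal_iff)
      have "t \<otimes> (\<alpha> \<otimes> \<pi>) \<in> carrier R #> (\<alpha> \<otimes> \<pi>)" using t by (auto simp: left_ideal_iff)
      then show "t \<otimes> (\<alpha> \<otimes> \<pi>) \<in> carrier R #> f" using bound_in by auto
    qed simp
    finally show ?thesis .
  qed
  have "?I \<subseteq> carrier R #> \<pi>"
  proof
    fix x assume "x \<in> ?I"
    then have x: "x \<in> carrier R" "\<And>m. m \<in> carrier R \<Longrightarrow> x \<otimes> m \<in> carrier R #> p"
      by (auto simp: quotient_annihilator_iff)
    \<comment> \<open>For each \<open>m\<close>, the product \<open>x \<otimes> m\<close> lies in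
      \<open>R p\<close>, so \<open>mult_in\<close> puts
      \<open>\<alpha> \<otimes> (x \<otimes> m)\<close> into \<open>R f\<close>.\<close>
    have "\<alpha> \<otimes> x \<in> quotient_annihilator R (carrier R #> f)"
      using x mult_in by (simp add: quotient_annihilator_iff m_assoc)
    then have "\<alpha> \<otimes> x \<in> carrier R #> (\<alpha> \<otimes> \<pi>)" using bound by (simp add: is_bound_def)
    then obtain r where r: "r \<in> carrier R" "\<alpha> \<otimes> x = r \<otimes> (\<alpha> \<otimes> \<pi>)"
      by (auto simp: left_ideal_iff)
    \<comment> \<open>The multiplier \<open>r\<close> stands to the left of \<open>\<alpha>\<close>;
      exchanging them brings \<open>\<alpha>\<close> to the front of both sides, ready for left
      cancellation.\<close>
    obtain s where s: "s \<in> carrier R" "r \<otimes> \<alpha> = \<alpha> \<otimes> s" using twosided_commute[OF \<alpha>] r by blast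
    have "\<alpha> \<otimes> x = (r \<otimes> \<alpha>) \<otimes> \<pi>" unfolding r using r(1) by (simp add: m_assoc)
    also have "\<dots> = \<alpha> \<otimes> (s \<otimes> \<pi>)" unfolding s using s(1) by (simp add: m_assoc)
    finally have "x = s \<otimes> \<pi>" using left_cancel[of \<alpha> x "s \<otimes> \<pi>"] nz x s by simp
    then show "x \<in> carrier R #> \<pi>" using s by (auto simp: left_ideal_iff)
  qed
  \<comment> \<open>Here \<open>\<pi>\<close> is a twosided element of \<open>R p\<close>, so
    maximality of the annihilator applies.\<close>
  moreover have "carrier R #> \<pi> \<subseteq> ?I"
    using twosided_in_annihilator \<pi> is_rgcd_divides(2)[OF p] by simp
  ultimately show ?thesis using \<pi> by (auto simp: is_bound_def)
qed

text \<open>Two swaps bring \<open>g\<close> to the right end of the bound \<open>c\<close>. From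
  \<open>c = h \<otimes> (g \<otimes> p)\<close> the first gives \<open>c = (g \<otimes> p)
  \<otimes> k = g \<otimes> (p \<otimes> k)\<close>, and the second turns this left factor
  \<open>g\<close> into a right factor.\<close>

lemma left_factor_bounded:
  assumes "bounded_elem R (g \<otimes> p)" "g \<in> carrier R" "p \<in> carrier R"
  shows "bounded_elem R g"
proof -
  obtain c where c: "is_bound R (g \<otimes> p) c" "c \<noteq> \<zero>" using assms by (auto simp: bounded_elem_def)
  then have tc: "twosided R c" "c \<in> carrier R" by (auto simp: is_bound_def twosided_def)
  have "c \<in> carrier R #> (g \<otimes> p)"
    using c self_in_left_ideal[OF tc(2)] quotient_annihilator_subset[of "g \<otimes> p"] assms
    by (auto simp: is_bound_def)
  then obtain h where "h \<in> carrier R" "c = h \<otimes> (g \<otimes> p)" by (auto simp: left_ideal_iff)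
  then have "c \<in> (g \<otimes> p) <# carrier R"
    using twosided_factor_swap(1)[of c h "g \<otimes> p"] tc c assms by simp
  then obtain k where k: "k \<in> carrier R" "c = g \<otimes> p \<otimes> k" by (auto simp: right_ideal_iff)
  then have "c = g \<otimes> (p \<otimes> k)" using assms by (simp add: m_assoc)
  then have "c \<in> carrier R #> g"
    using twosided_factor_swap(2)[of c g "p \<otimes> k"] tc c assms k(1) by simp
  then show ?thesis using bounded_elemI tc c assms by blast
qed

text \<open>Writing \<open>b = x \<otimes> a \<otimes> b\<close> and cancelling \<open>b\<close>
  gives \<open>a\<close> a left inverse, which suffices for a unit.\<close>

lemma left_ideal_eq_imp_unit:
  assumes "a \<in> carrier R" "b \<in> carrier R" "b \<noteq> \<zero>" "carrier R #> (a \<otimes> b) = carrier R #> b"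
  shows "a \<in> Units R"
proof -
  have "b \<in> carrier R #> (a \<otimes> b)" using assms self_in_left_ideal[of b] by simp
  then obtain x where x: "x \<in> carrier R" "b = x \<otimes> (a \<otimes> b)"
    by (auto simp: left_ideal_iff)
  have "(x \<otimes> a) \<otimes> b = \<one> \<otimes> b" using assms x by (simp add: m_assoc)
  then have "x \<otimes> a = \<one>" using right_cancel[of b "x \<otimes> a" \<one>] x(1) assms by simp
  then show ?thesis using UnitsI_left_inverse assms x by blast
qed

theorem rgcd_proper_factorization:
  assumes f: "bounded_elem R f" and bound: "is_bound R f fstar"
    and div: "proper_twosided_divisor R \<pi> fstar" and p: "is_rgcd R f \<pi> p"
  shows "right_divides R p f" and "is_bound R p \<pi>"
    and "\<exists>g\<in>carrier R. bounded_elem R g \<and> f = g \<otimes> p \<and> g \<notin> Units R \<and> p \<notin> Units R"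
proof -
  obtain \<alpha> where \<alpha>: "twosided R \<alpha>" "\<alpha> \<notin> Units R" "fstar = \<alpha> \<otimes> \<pi>"
    using div by (auto simp: proper_twosided_divisor_def)
  have \<pi>: "twosided R \<pi>" "\<pi> \<notin> Units R" using div by (auto simp: proper_twosided_divisor_def)
  have c: "f \<in> carrier R" "\<alpha> \<in> carrier R" "\<pi> \<in> carrier R" "p \<in> carrier R"
    using f p \<alpha> \<pi> by (auto simp: bounded_elem_def is_rgcd_def twosided_def)
  \<comment> \<open>Both factors of the nonzero bound \<open>fstar\<close> are nonzero.\<close>
  have nz: "\<alpha> \<noteq> \<zero>" "\<pi> \<noteq> \<zero>" using bounded_elem_bound_nonzero[OF f bound] \<alpha>(3) c by auto
  show bp: "is_bound R p \<pi>"
    using rgcd_is_bound c(1) bound nz(1) \<alpha>(1,3) \<pi>(1) p by blast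
  obtain g where g: "g \<in> carrier R" "f = g \<otimes> p"
    using is_rgcd_divides(1)[OF p c(1,3)] by (auto simp: left_ideal_iff)
  then show "right_divides R p f" by (auto simp: right_divides_def)
  \<comment> \<open>For a unit \<open>p\<close> the module \<open>R/Rp\<close> is zero, so
    \<open>\<one>\<close> annihilates it; then \<open>\<one>\<close> lies in \<open>R \<pi>\<close>
    and \<open>\<pi>\<close> would be a unit.\<close>
  have "p \<notin> Units R"
  proof
    assume "p \<in> Units R"
    then have "carrier R #> p = carrier R #> \<one>"
      using left_ideal_unit[of p \<one>] c by simp
    also have "\<dots> = carrier R" by (auto simp: left_ideal_iff)
    finally have "m \<in> carrier R #> p" if "m \<in> carrier R" for m using that by simp
    then have "\<one> \<in> quotient_annihilator R (carrier R #> p)"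
      using c by (simp add: quotient_annihilator_iff)
    then have "\<one> \<in> carrier R #> \<pi>" using bp by (simp add: is_bound_def)
    then have "\<pi> \<in> Units R" using UnitsI_left_inverse c by (auto simp: left_ideal_iff)
    then show False using \<pi> by simp
  qed
  \<comment> \<open>For a unit \<open>g\<close> the elements \<open>f\<close> and \<open>p\<close>
    generate the same left ideal and have the same annihilator, so
    \<open>\<alpha> \<otimes> \<pi>\<close> and \<open>\<pi>\<close> do too, forcing
    \<open>\<alpha>\<close> to be a unit.\<close>
  moreover have "g \<notin> Units R"
  proof
    assume "g \<in> Units R"
    then have "carrier R #> f = carrier R #> p" using left_ideal_unit c g by simp
    then have "carrier R #> (\<alpha> \<otimes> \<pi>) = carrier R #> \<pi>"
      using bound bp \<alpha>(3) by (simp add: is_bound_def)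
    then show False using left_ideal_eq_imp_unit c nz \<alpha> by blast
  qed
  moreover have "bounded_elem R g" using left_factor_bounded f g c by blast
  ultimately show "\<exists>g\<in>carrier R. bounded_elem R g \<and> f = g \<otimes> p \<and> g \<notin> Units R \<and> p \<notin> Units R"
    using g by blast
qed

end

section \<open>Division with remainder for skew polynomials\<close>

text \<open>The alternative \<open>a - b = 0\<close> is listed separately because the zero
  polynomial has degree 0, which is no strict drop when \<open>a\<close> is constant.\<close>

lemma cancel_top:
  fixes a b :: "'a::ab_group_add poly"
  assumes "degree b \<le> degree a" "coeff b (degree a) = lead_coeff a"
  shows "a - b = 0 \<or> degree (a - b) < degree a"
proof (cases "a - b = 0")
  case False
  have "degree (a - b) \<le> degree a" using assms(1) by (intro degree_le) (auto simp: coeff_eq_0)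
  moreover have "degree (a - b) \<noteq> degree a"
  proof
    assume "degree (a - b) = degree a"
    then have "lead_coeff (a - b) = 0" using assms(2) by simp
    then show False using False by (simp only: leading_coeff_0_iff)
  qed
  ultimately show ?thesis by simp
qed simp

text \<open>\<open>F\<close> stands for multiplication by \<open>b\<close> on either side.
  Additivity lets the partial quotients accumulate, so one induction on \<open>degree a\<close>
  yields both divisions.\<close>

lemma division_by_steps:
  fixes a b :: "'a::ab_group_add poly" and F :: "'a poly \<Rightarrow> 'a poly"
  assumes step: "\<And>a. a \<noteq> 0 \<Longrightarrow> degree b \<le> degree a \<Longrightarrow>
      \<exists>q. a - F q = 0 \<or> degree (a - F q) < degree a"
    and add: "\<And>q q'. F (q + q') = F q + F q'" and zero: "F 0 = 0"
  shows "\<exists>q r. a = F q + r \<and> (r = 0 \<or> degree r < degree b)"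
proof (induction "degree a" arbitrary: a rule: less_induct)
  case less
  show ?case
  proof (cases "a = 0 \<or> degree a < degree b")
    case True
    then show ?thesis using zero by (intro exI[of _ 0] exI[of _ a]) auto
  next
    case False
    then obtain q where q: "a - F q = 0 \<or> degree (a - F q) < degree a"
      using step[of a] by auto
    then show ?thesis
    proof
      assume "a - F q = 0"
      then show ?thesis by (intro exI[of _ q] exI[of _ 0]) auto
    next
      assume "degree (a - F q) < degree a"
      then obtain q' r where "a - F q = F q' + r" "r = 0 \<or> degree r < degree b"
        using less by blast
      then show ?thesis
        by (intro exI[of _ "q' + q"] exI[of _ r]) (auto simp: add algebra_simps)
    qed
  qed
qed

section \<open>Leading terms of skew products, and division from both sides\<close>

context
  fixes \<sigma> \<delta> :: "'a::division_ring \<Rightarrow> 'a"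
  assumes aut: "ring_automorphism \<sigma>" and der: "skew_derivation \<sigma> \<delta>"
begin

lemma aut_zero: "\<sigma> 0 = 0" and der_zero: "\<delta> 0 = 0"
proof -
  have "\<sigma> (0 + 0) = \<sigma> 0 + \<sigma> 0" "\<delta> (0 + 0) = \<delta> 0 + \<delta> 0"
    using aut der unfolding ring_automorphism_def skew_derivation_def by blast+
  then show "\<sigma> 0 = 0" "\<delta> 0 = 0" by auto
qed

lemma aut_pow_bij: "bij (\<sigma> ^^ i)"
  using aut by (simp add: bij_fn ring_automorphism_def)

lemma aut_pow_zero: "(\<sigma> ^^ i) 0 = 0"
  by (induction i) (auto simp: aut_zero)

lemma aut_pow_eq_zero_iff: "(\<sigma> ^^ i) a = 0 \<longleftrightarrow> a = 0"
  using aut_pow_zero[of i] bij_is_inj[OF aut_pow_bij[of i]] by (metis injD)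

text \<open>Each multiplication by \<open>X\<close> shifts the top coefficient up by one and applies
  \<open>\<sigma>\<close> to it; the \<open>\<delta>\<close> part does not raise the degree and so
  never reaches the new top position.\<close>

lemma skew_X_pow_top:
  assumes "degree q \<le> n"
  shows "degree ((skew_X_mult \<sigma> \<delta> ^^ i) q) \<le> n + i \<and>
    coeff ((skew_X_mult \<sigma> \<delta> ^^ i) q) (n + i) = (\<sigma> ^^ i) (coeff q n)"
proof (induction i)
  case (Suc i)
  let ?q = "(skew_X_mult \<sigma> \<delta> ^^ i) q"
  have "coeff (skew_X_mult \<sigma> \<delta> ?q) k =
      (case k of 0 \<Rightarrow> 0 | Suc m \<Rightarrow> \<sigma> (coeff ?q m)) + \<delta> (coeff ?q k)" for k
    by (simp add: skew_X_mult_def coeff_pCons coeff_map_poly aut_zero der_zero split: nat.split)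
  then show ?case using Suc
    by (auto intro!: degree_le simp: coeff_eq_0 aut_zero der_zero split: nat.split)
qed (use assms in simp)

text \<open>The summand for \<open>X ^ i\<close> reaches at most degree \<open>degree q + i\<close>,
  so only \<open>i = degree p\<close> contributes to the top coefficient.\<close>

lemma skew_mult_top:
  "degree (skew_mult \<sigma> \<delta> p q) \<le> degree p + degree q"
  "coeff (skew_mult \<sigma> \<delta> p q) (degree p + degree q) =
     lead_coeff p * (\<sigma> ^^ degree p) (lead_coeff q)"
proof -
  let ?T = "\<lambda>i. (skew_X_mult \<sigma> \<delta> ^^ i) q"
  have top: "degree (?T i) \<le> degree q + i"
    "coeff (?T i) (degree q + i) = (\<sigma> ^^ i) (lead_coeff q)" for i
    using skew_X_pow_top[of q "degree q" i] by auto
  have co: "coeff (skew_mult \<sigma> \<delta> p q) k = (\<Sum>i\<le>degree p. coeff p i * coeff (?T i) k)" for k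
    by (simp add: skew_mult_def skew_lscale_def coeff_sum coeff_map_poly)
  have low: "coeff (?T i) k = 0" if "degree q + i < k" for i k
    using top(1)[of i] that by (intro coeff_eq_0) simp
  show "degree (skew_mult \<sigma> \<delta> p q) \<le> degree p + degree q"
    by (intro degree_le allI impI) (auto simp: co intro!: sum.neutral low)
  have "(\<Sum>i\<le>degree p. coeff p i * coeff (?T i) (degree p + degree q)) =
      (\<Sum>i\<in>{degree p}. coeff p i * coeff (?T i) (degree p + degree q))"
    by (intro sum.mono_neutral_right) (auto intro!: low)
  then show "coeff (skew_mult \<sigma> \<delta> p q) (degree p + degree q) =
      lead_coeff p * (\<sigma> ^^ degree p) (lead_coeff q)"
    using top(2)[of "degree p"] by (simp add: co add.commute)
qed

text \<open>The top coefficient of the product vanishes, and in a skew field with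
  \<open>\<sigma>\<close> injective this kills one of the leading coefficients.\<close>

lemma skew_mult_eq_0: "skew_mult \<sigma> \<delta> p q = 0 \<Longrightarrow> p = 0 \<or> q = 0"
  using skew_mult_top(2)[of p q] by (auto simp: aut_pow_eq_zero_iff)

lemma skew_left_division_step:
  assumes "b \<noteq> 0" "a \<noteq> 0" "degree b \<le> degree a"
  obtains q where "a - skew_mult \<sigma> \<delta> q b = 0 \<or> degree (a - skew_mult \<sigma> \<delta> q b) < degree a"
proof -
  let ?k = "degree a - degree b"
  let ?u = "(\<sigma> ^^ ?k) (lead_coeff b)"
  \<comment> \<open>The product \<open>?q\<close> times \<open>b\<close> has top coefficient
    \<open>lead_coeff ?q * ?u\<close>; the factor \<open>inverse ?u\<close> on the right makes it
    equal to \<open>lead_coeff a\<close>.\<close>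
  let ?q = "monom (lead_coeff a * inverse ?u) ?k"
  have u: "?u \<noteq> 0" using assms by (simp add: aut_pow_eq_zero_iff)
  then have d: "degree ?q = ?k" using assms(2) by (intro degree_monom_eq) simp
  then have e: "degree ?q + degree b = degree a" using assms(3) by simp
  have "lead_coeff a * inverse ?u * ?u = lead_coeff a" using u by (simp add: mult.assoc)
  then have "a - skew_mult \<sigma> \<delta> ?q b = 0 \<or> degree (a - skew_mult \<sigma> \<delta> ?q b) < degree a"
    using skew_mult_top[of ?q b, unfolded e]
    by (intro cancel_top) (simp_all only: d coeff_monom simp_thms if_True)
  then show ?thesis by (rule that)
qed

lemma skew_right_division_step:
  assumes "b \<noteq> 0" "a \<noteq> 0" "degree b \<le> degree a"
  obtains q where "a - skew_mult \<sigma> \<delta> b q = 0 \<or> degree (a - skew_mult \<sigma> \<delta> b q) < degree a"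
proof -
  let ?k = "degree a - degree b"
  \<comment> \<open>On this side \<open>\<sigma>\<close> acts on the unknown coefficient: the top
    coefficient is \<open>lead_coeff b * (\<sigma> ^^ degree b) c\<close>. Solving for
    \<open>c\<close> takes a preimage, which is where surjectivity of \<open>\<sigma>\<close>
    enters.\<close>
  obtain c where c: "inverse (lead_coeff b) * lead_coeff a = (\<sigma> ^^ degree b) c"
    using surjD[OF bij_is_surj[OF aut_pow_bij]] by blast
  let ?q = "monom c ?k"
  have "c \<noteq> 0" using c assms by (auto simp: aut_pow_zero)
  then have d: "degree ?q = ?k" by (intro degree_monom_eq)
  then have e: "degree b + degree ?q = degree a" using assms(3) by simp
  have "lead_coeff b * (inverse (lead_coeff b) * lead_coeff a) = lead_coeff a"
    using assms by (simp flip: mult.assoc)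
  then have "a - skew_mult \<sigma> \<delta> b ?q = 0 \<or> degree (a - skew_mult \<sigma> \<delta> b ?q) < degree a"
    using skew_mult_top[of b ?q, unfolded e]
    by (intro cancel_top) (simp_all only: d c[symmetric] coeff_monom simp_thms if_True)
  then show ?thesis by (rule that)
qed

lemma skew_poly_ring_euclidean: "twosided_euclidean_domain (skew_poly_ring \<sigma> \<delta>) degree"
proof -
  interpret ring "skew_poly_ring \<sigma> \<delta>" by (rule ring_skew_poly_ring[OF aut der])
  have sel: "x \<otimes>\<^bsub>skew_poly_ring \<sigma> \<delta>\<^esub> y = skew_mult \<sigma> \<delta> x y"
    "x \<oplus>\<^bsub>skew_poly_ring \<sigma> \<delta>\<^esub> y = x + y" "\<zero>\<^bsub>skew_poly_ring \<sigma> \<delta>\<^esub> = 0"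
    "carrier (skew_poly_ring \<sigma> \<delta>) = UNIV" for x y
    by (auto simp: skew_poly_ring_def)
  \<comment> \<open>Distributivity and the zero laws of \<open>skew_mult\<close> are read off from
    the ring laws of \<open>skew_poly_ring\<close>.\<close>
  have arith: "skew_mult \<sigma> \<delta> (x + y) z = skew_mult \<sigma> \<delta> x z + skew_mult \<sigma> \<delta> y z"
    "skew_mult \<sigma> \<delta> z (x + y) = skew_mult \<sigma> \<delta> z x + skew_mult \<sigma> \<delta> z y"
    "skew_mult \<sigma> \<delta> 0 z = 0" "skew_mult \<sigma> \<delta> z 0 = 0" for x y z
    using l_distr[of x y z] r_distr[of x y z] l_null[of z] r_null[of z] by (auto simp: sel)
  have left: "\<exists>q r. a = skew_mult \<sigma> \<delta> q b + r \<and> (r = 0 \<or> degree r < degree b)"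
    and right: "\<exists>q r. a = skew_mult \<sigma> \<delta> b q + r \<and> (r = 0 \<or> degree r < degree b)"
    if "b \<noteq> 0" for a b
  proof -
    show "\<exists>q r. a = skew_mult \<sigma> \<delta> q b + r \<and> (r = 0 \<or> degree r < degree b)"
    proof (rule division_by_steps[where F = "\<lambda>q. skew_mult \<sigma> \<delta> q b"])
      fix a :: "'a poly" assume "a \<noteq> 0" "degree b \<le> degree a"
      then show "\<exists>q. a - skew_mult \<sigma> \<delta> q b = 0 \<or> degree (a - skew_mult \<sigma> \<delta> q b) < degree a"
        using skew_left_division_step[OF \<open>b \<noteq> 0\<close>] by blast
    qed (simp_all add: arith)
    show "\<exists>q r. a = skew_mult \<sigma> \<delta> b q + r \<and> (r = 0 \<or> degree r < degree b)"
    proof (rule division_by_steps[where F = "skew_mult \<sigma> \<delta> b"])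
      fix a :: "'a poly" assume "a \<noteq> 0" "degree b \<le> degree a"
      then show "\<exists>q. a - skew_mult \<sigma> \<delta> b q = 0 \<or> degree (a - skew_mult \<sigma> \<delta> b q) < degree a"
        using skew_right_division_step[OF \<open>b \<noteq> 0\<close>] by blast
    qed (simp_all add: arith)
  qed
  show ?thesis
  proof (unfold_locales, unfold sel)
    show "a = 0 \<or> b = 0" if "skew_mult \<sigma> \<delta> a b = 0" for a b
      using that by (rule skew_mult_eq_0)
  qed (use left right in auto)
qed

end

theorem proposition5p1:
  fixes \<sigma> \<delta> :: "'a::division_ring \<Rightarrow> 'a"
    and R :: "'a poly ring" (structure)
    and f fstar \<pi> :: "'a poly"
  assumes "ring_automorphism \<sigma>"
    and "skew_derivation \<sigma> \<delta>"
    and "R = skew_poly_ring \<sigma> \<delta>"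
    and "f \<in> carrier R"
    and "bounded_elem R f"
    and "is_bound R f fstar"
    and "proper_twosided_divisor R \<pi> fstar"
  shows "(\<exists>p. is_rgcd R f \<pi> p) \<and>
    (\<forall>p. is_rgcd R f \<pi> p \<longrightarrow>
       right_divides R p f \<and> is_bound R p \<pi> \<and>
       (\<exists>g \<in> carrier R. bounded_elem R g \<and> f = g \<otimes> p \<and> g \<notin> Units R \<and> p \<notin> Units R))"
proof -
  interpret twosided_euclidean_domain R degree
    using skew_poly_ring_euclidean assms(1-3) by simp
  have "\<pi> \<in> carrier R"
    using assms(7) by (simp add: proper_twosided_divisor_def twosided_def)
  show ?thesis
  proof (intro conjI allI impI)
    \<comment> \<open>Existence keeps the universal claim about all generators \<open>p\<close> from
      being vacuous.\<close>
    show "\<exists>p. is_rgcd R f \<pi> p"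
      using is_rgcd_exists[OF assms(4) \<open>\<pi> \<in> carrier R\<close>] by blast
  qed (fact rgcd_proper_factorization[OF assms(5-7)])+
qed

end
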